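(* Assume (NON-INC) and (POS), and that $\lambda$ is non-increasing. Then for every $\epsilon,\tau_1,\tau_2\in[0,T]$ with $\tau_2+\epsilon\le T$ such that (i) $\tau_1<\tau_2$, (ii) $S(\tau_1)\ge S(\tau_2)$, (iii) $S(\tau_1)\le\Lambda(\tau_2)$, (iv) $c_1\le\Big[\dfrac{\Lambda(u)-S(\tau_1)}{\Lambda(u)}\Big]\lambda(u)c_3(u)$ for all $u\in[\tau_2,\tau_2+\epsilon]$ (with $\Lambda(u)>0$ there), we have $S(\tau_2)\le S(\tau_2+\epsilon)$.
   Context: $T\in[0,\infty)$; $N=(N_t)_{t\in[0,T]}$ is a non-homogeneous Poisson process ($N_0=0$) with intensity $\lambda:[0,T]\to\mathbb{R}_+$, which is right-continuous with left limits and differentiable except at finitely many points; $\Lambda(t)=\int_0^t\lambda(u)\,du$. Constants $\bar c,c_1\in\mathbb{R}_+$ ($\bar c$ is the unit purchasing cost), $c_4\in\mathbb{R}$ with $\bar c>-c_4$, $\delta\in[0,1]$; functions $c_2,c_3:[0,T]\to\mathbb{R}_+$; $\widetilde c_2:=c_2-c_3$. For $x\in\mathbb{Z}_+$ let $\sigma_x=\inf\{u>0:N_u\ge x\}$ ($\inf\emptyset=\infty$). For $\tau\in[0,T]$ (a deterministic switching time), $$\mathcal{C}(x,\tau)=c_1\mathbb{E}\Big[\int_0^\tau e^{-\delta u}(x-N_u)^+du\Big]+\mathbb{E}\Big[\int_{\tau\wedge\sigma_x}^{\tau}e^{-\delta u}c_2(u)\,dN_u\Big]+\mathbb{E}\Big[\int_\tau^Te^{-\delta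 u}c_3(u)\,dN_u\Big]+c_4e^{-\delta\tau}\mathbb{E}[(x-N_\tau)^+],$$ where $\int_a^b(\cdot)\,dN_u$ is the integral over $(a,b]$. With $\Delta_x\mathcal{C}(x,\tau):=\mathcal{C}(x+1,\tau)-\mathcal{C}(x,\tau)$, the order-up-to level is $$S(\tau)=\min\{x\in\mathbb{Z}_+:\bar c+\Delta_x\mathcal{C}(x,\tau)\ge0\}.$$ (Under the assumptions below, $x\mapsto\mathcal{C}(x,\tau)$ is discrete-convex for each $\tau$.) (NON-INC): $c_3$ and $\widetilde c_2$ are right-continuous with left limits, differentiable except at finitely many points, and non-increasing on $[0,T]$. (POS): $c_3$ and $\widetilde c_2$ are non-negative, $c_4\ge0$ and $c_1-\delta c_4\ge0$. *)

theory Defs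
  imports "HOL-Probability.Probability"
begin

text \<open>
  Functions on \<open>[0,T]\<close> are represented by functions on the reals of which only the values on
  \<open>{0..T}\<close> matter. Exceptional points of differentiability may include the endpoints, so
  one- or two-sided differentiability there makes no difference.
\<close>

definition cadlag :: "real \<Rightarrow> (real \<Rightarrow> real) \<Rightarrow> bool" where
  "cadlag T f \<longleftrightarrow>
     (\<forall>t\<in>{0..<T}. (f \<longlongrightarrow> f t) (at_right t)) \<and>
     (\<forall>t\<in>{0<..T}. \<exists>l. (f \<longlongrightarrow> l) (at_left t))"

definition differentiable_except_finite :: "real \<Rightarrow> (real \<Rightarrow> real) \<Rightarrow> bool" where
  "differentiable_except_finite T f \<longleftrightarrow>
     (\<exists>F. finite F \<and> (\<forall>t\<in>{0..T} - F. f differentiable (at t within {0..T})))"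

definition cum_intensity :: "(real \<Rightarrow> real) \<Rightarrow> real \<Rightarrow> real" where
  "cum_intensity lam t = (LINT u:{0..t}|lborel. lam u)"

text \<open>
  The Poisson probabilities are spelled out because the intensity may vanish on an interval,
  whereas \<^const>\<open>poisson_pmf\<close> is only specified for positive rates.
\<close>

definition nh_poisson_process ::
  "'a measure \<Rightarrow> real \<Rightarrow> (real \<Rightarrow> real) \<Rightarrow> (real \<Rightarrow> 'a \<Rightarrow> nat) \<Rightarrow> bool" where
  "nh_poisson_process M T lam N \<longleftrightarrow>
     prob_space M \<and>
     (\<forall>t\<in>{0..T}. N t \<in> M \<rightarrow>\<^sub>M count_space UNIV) \<and>
     (\<forall>\<omega>\<in>space M. N 0 \<omega> = 0 \<and> mono_on {0..T} (\<lambda>t. N t \<omega>) \<and> cadlag T (\<lambda>t. real (N t \<omega>))) \<and>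
     (\<forall>n (t :: nat \<Rightarrow> real). 0 \<le> t 0 \<and> (\<forall>i<n. t i \<le> t (Suc i)) \<and> t n \<le> T \<longrightarrow>
        prob_space.indep_vars M (\<lambda>_. borel)
          (\<lambda>i \<omega>. real (N (t (Suc i)) \<omega>) - real (N (t i) \<omega>)) {..<n}) \<and>
     (\<forall>s t k. 0 \<le> s \<and> s \<le> t \<and> t \<le> T \<longrightarrow>
        measure M {\<omega>\<in>space M. N t \<omega> - N s \<omega> = k} =
          (cum_intensity lam t - cum_intensity lam s) ^ k / fact k *
          exp (- (cum_intensity lam t - cum_intensity lam s)))"

text \<open>
  The Lebesgue-Stieltjes measure of a path; the path is frozen outside \<open>[0,T]\<close>, so the measure
  has no mass outside \<open>(0,T]\<close>.
\<close>

definition path_measure :: "real \<Rightarrow> (real \<Rightarrow> 'a \<Rightarrow> nat) \<Rightarrow> 'a \<Rightarrow> real measure" where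
  "path_measure T N \<omega> = interval_measure (\<lambda>t. real (N (max 0 (min T t)) \<omega>))"

definition hitting_time :: "real \<Rightarrow> (real \<Rightarrow> 'a \<Rightarrow> nat) \<Rightarrow> nat \<Rightarrow> 'a \<Rightarrow> ereal" where
  "hitting_time T N x \<omega> = Inf {ereal u | u. 0 < u \<and> u \<le> T \<and> N u \<omega> \<ge> x}"

definition cost ::
  "'a measure \<Rightarrow> real \<Rightarrow> (real \<Rightarrow> 'a \<Rightarrow> nat) \<Rightarrow> real \<Rightarrow> (real \<Rightarrow> real) \<Rightarrow> (real \<Rightarrow> real) \<Rightarrow> real \<Rightarrow>
   real \<Rightarrow> nat \<Rightarrow> real \<Rightarrow> real" where
  "cost M T N c1 c2 c3 c4 \<delta> x \<tau> =
     c1 * (LINT \<omega>|M. (LINT u:{0..\<tau>}|lborel. exp (- \<delta> * u) * max (real x - real (N u \<omega>)) 0))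
     + (LINT \<omega>|M. (LINT u:{u. min (ereal \<tau>) (hitting_time T N x \<omega>) < ereal u \<and> u \<le> \<tau>}|path_measure T N \<omega>.
          exp (- \<delta> * u) * c2 u))
     + (LINT \<omega>|M. (LINT u:{\<tau><..T}|path_measure T N \<omega>. exp (- \<delta> * u) * c3 u))
     + c4 * exp (- \<delta> * \<tau>) * (LINT \<omega>|M. max (real x - real (N \<tau> \<omega>)) 0)"

text \<open>
  For \<open>cbar, c1 \<ge> 0\<close> and \<open>cbar > - c4\<close> the minimum is attained: as \<open>x\<close> grows, the increment
  of the cost tends to \<open>c1 * (LINT u:{0..\<tau>}|lborel. exp (- \<delta> * u)) + c4 * exp (- \<delta> * \<tau>)\<close>.
\<close>

definition order_up_to ::
  "'a measure \<Rightarrow> real \<Rightarrow> (real \<Rightarrow> 'a \<Rightarrow> nat) \<Rightarrow> real \<Rightarrow> real \<Rightarrow> (real \<Rightarrow> real) \<Rightarrow> (real \<Rightarrow> real) \<Rightarrow>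
   real \<Rightarrow> real \<Rightarrow> real \<Rightarrow> nat" where
  "order_up_to M T N cbar c1 c2 c3 c4 \<delta> \<tau> =
     (LEAST x. cbar + (cost M T N c1 c2 c3 c4 \<delta> (x + 1) \<tau> - cost M T N c1 c2 c3 c4 \<delta> x \<tau>) \<ge> 0)"

end

(*
  Writing P_x(m) and p_x(m) for the Poisson distribution function and weight at x with mean m, the
  increment of the cost in x is
    D(x, t) = INT_0^t exp(-delta u) (c1 P_x(Lambda u) - lambda(u) c2(u) p_x(Lambda u)) du
              + c4 exp(-delta t) P_x(Lambda t):
  the (x+1)-st unit is held while N <= x and saves the shortage cost at the jump from x to x + 1,
  and the c3-integral does not depend on x. Its last summand is non-increasing in t. Since
  P_x(m) (m - x) <= m p_x(m), condition (iv) and c3 <= c2 make the integrand non-positive on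
  [tau2, tau2 + eps] for every x < S(tau1), so D(x, .) is non-increasing there. Hence an x < S(tau2)
  that is too small at tau2 is still too small at tau2 + eps.

  The expectations of the pathwise integrals are computed by approximating the integrands by step
  functions on equidistant grids, so that neither jump times nor the simplicity of the jumps
  (nor joint measurability of the process) have to be considered.
*)
theory Submission
  imports Defs
begin

definition grid :: "real \<Rightarrow> nat \<Rightarrow> nat \<Rightarrow> real" where
  "grid \<tau> n i = \<tau> * real i / real (Suc n)"

definition grid_step :: "real \<Rightarrow> nat \<Rightarrow> (real \<Rightarrow> real \<Rightarrow> real) \<Rightarrow> real \<Rightarrow> real" where
  "grid_step \<tau> n g u =
     (\<Sum>i<Suc n. indicator {grid \<tau> n i<..grid \<tau> n (Suc i)} u * g (grid \<tau> n i) (grid \<tau> n (Suc i)))"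

text \<open>
  Integrands may use the left endpoint of a cell: this makes them predictable, so that on a cell the
  integrand is independent of the increment of the process.
\<close>

definition grid_limit :: "real \<Rightarrow> (real \<Rightarrow> real \<Rightarrow> real) \<Rightarrow> (real \<Rightarrow> real) \<Rightarrow> bool" where
  "grid_limit \<tau> g G \<longleftrightarrow>
     (\<forall>u l r. 0 < u \<and> u \<le> \<tau> \<and> (\<forall>n. 0 \<le> l n \<and> l n < u \<and> u \<le> r n \<and> r n \<le> \<tau>) \<and>
        l \<longlonglongrightarrow> u \<and> r \<longlonglongrightarrow> u \<longrightarrow> (\<lambda>n::nat. g (l n) (r n)) \<longlonglongrightarrow> G u)"

lemma grid_bounds:
  assumes "0 < \<tau>" "i < Suc n"
  shows "0 \<le> grid \<tau> n i" "grid \<tau> n i \<le> grid \<tau> n (Suc i)" "grid \<tau> n (Suc i) \<le> \<tau>"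
proof -
  show "0 \<le> grid \<tau> n i" using assms by (simp add: grid_def)
  show "grid \<tau> n i \<le> grid \<tau> n (Suc i)"
    using assms by (simp add: grid_def field_simps)
  have "\<tau> * real (Suc i) \<le> \<tau> * real (Suc n)"
    using assms by (intro mult_left_mono) auto
  then show "grid \<tau> n (Suc i) \<le> \<tau>"
    by (simp add: grid_def pos_divide_le_eq del: of_nat_Suc)
qed

lemma grid_cell_iff:
  assumes "0 < \<tau>"
  shows "u \<in> {grid \<tau> n i<..grid \<tau> n (Suc i)} \<longleftrightarrow> \<lceil>u * real (Suc n) / \<tau>\<rceil> = int i + 1"
proof -
  have "grid \<tau> n i < u \<longleftrightarrow> real i < u * real (Suc n) / \<tau>"
    using assms by (simp add: grid_def pos_divide_less_eq pos_less_divide_eq mult.commute del: of_nat_Suc)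
  moreover have "u \<le> grid \<tau> n (Suc i) \<longleftrightarrow> u * real (Suc n) / \<tau> \<le> real i + 1"
    using assms by (simp add: grid_def pos_divide_le_eq pos_le_divide_eq algebra_simps)
  ultimately show ?thesis by (auto simp: ceiling_eq_iff)
qed

lemma grid_cell_subset:
  assumes "0 < \<tau>" "i < Suc n" "u \<in> {grid \<tau> n i<..grid \<tau> n (Suc i)}"
  shows "u \<in> {0<..\<tau>}"
  using grid_bounds[OF assms(1,2)] assms(3) by auto

lemma grid_step_outside:
  assumes "0 < \<tau>" "u \<notin> {0<..\<tau>}"
  shows "grid_step \<tau> n g u = 0"
  unfolding grid_step_def
proof (rule sum.neutral, intro ballI)
  fix i assume "i \<in> {..<Suc n}"
  then have "u \<notin> {grid \<tau> n i<..grid \<tau> n (Suc i)}"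
    using grid_cell_subset[of \<tau> i n u] assms by auto
  then show "indicator {grid \<tau> n i<..grid \<tau> n (Suc i)} u * g (grid \<tau> n i) (grid \<tau> n (Suc i)) = 0"
    by simp
qed

lemma grid_step_cell:
  assumes "0 < \<tau>" "u \<in> {0<..\<tau>}"
  obtains l r where "0 \<le> l" "l < u" "u \<le> r" "r \<le> \<tau>" "r - l = \<tau> / real (Suc n)"
    "\<And>g. grid_step \<tau> n g u = g l r"
proof -
  define k where "k = nat (\<lceil>u * real (Suc n) / \<tau>\<rceil> - 1)"
  have pos: "0 < u * real (Suc n) / \<tau>" using assms by auto
  have le: "u * real (Suc n) / \<tau> \<le> real (Suc n)"
    using assms by (simp add: pos_divide_le_eq mult.commute del: of_nat_Suc)
  have ceil: "\<lceil>u * real (Suc n) / \<tau>\<rceil> = int k + 1"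
    using pos unfolding k_def by linarith
  have "int k + 1 \<le> int (Suc n)"
    using le ceil by (metis ceiling_le_iff of_int_of_nat_eq)
  then have kn: "k < Suc n" by simp
  have cell: "u \<in> {grid \<tau> n i<..grid \<tau> n (Suc i)} \<longleftrightarrow> i = k" for i
    using grid_cell_iff[OF assms(1)] ceil by auto
  have "grid_step \<tau> n g u = (\<Sum>i<Suc n. if i = k then g (grid \<tau> n i) (grid \<tau> n (Suc i)) else 0)" for g
    unfolding grid_step_def by (rule sum.cong) (use cell in \<open>auto simp: indicator_def\<close>)
  then have val: "grid_step \<tau> n g u = g (grid \<tau> n k) (grid \<tau> n (Suc k))" for g
    using kn by simp
  have "grid \<tau> n (Suc k) - grid \<tau> n k = \<tau> / real (Suc n)"
    by (simp add: grid_def diff_divide_distrib[symmetric] right_diff_distrib[symmetric] del: of_nat_Suc)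
  then show ?thesis
    using that[of "grid \<tau> n k" "grid \<tau> n (Suc k)"] val grid_bounds[OF assms(1) kn] cell[of k] by auto
qed

lemma grid_step_tendsto:
  assumes "0 < \<tau>" "grid_limit \<tau> g G"
  shows "(\<lambda>n. grid_step \<tau> n g u) \<longlonglongrightarrow> indicator {0<..\<tau>} u * G u"
proof (cases "u \<in> {0<..\<tau>}")
  case True
  have "\<forall>n. \<exists>l r. 0 \<le> l \<and> l < u \<and> u \<le> r \<and> r \<le> \<tau> \<and> r - l = \<tau> / real (Suc n)
      \<and> grid_step \<tau> n g u = g l r"
    using grid_step_cell[OF assms(1) True] by metis
  then obtain l r where lr: "\<And>n. 0 \<le> l n \<and> l n < u \<and> u \<le> r n \<and> r n \<le> \<tau>
      \<and> r n - l n = \<tau> / real (Suc n) \<and> grid_step \<tau> n g u = g (l n) (r n)"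
    by metis
  have z: "(\<lambda>n. \<tau> / real (Suc n)) \<longlonglongrightarrow> 0"
    by (rule lim_const_over_n[THEN LIMSEQ_Suc])
  have "l \<longlonglongrightarrow> u"
  proof (rule tendsto_sandwich[OF _ _ _ tendsto_const])
    show "\<forall>\<^sub>F n in sequentially. u - \<tau> / real (Suc n) \<le> l n"
      using lr by (intro always_eventually allI) (smt (verit))
    show "\<forall>\<^sub>F n in sequentially. l n \<le> u" using lr by (auto intro!: always_eventually less_imp_le)
    show "(\<lambda>n. u - \<tau> / real (Suc n)) \<longlonglongrightarrow> u" using tendsto_diff[OF tendsto_const z] by simp
  qed
  moreover have "r \<longlonglongrightarrow> u"
  proof (rule tendsto_sandwich[OF _ _ tendsto_const])
    show "\<forall>\<^sub>F n in sequentially. r n \<le> u + \<tau> / real (Suc n)"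
      using lr by (intro always_eventually allI) (smt (verit))
    show "\<forall>\<^sub>F n in sequentially. u \<le> r n" using lr by auto
    show "(\<lambda>n. u + \<tau> / real (Suc n)) \<longlonglongrightarrow> u" using tendsto_add[OF tendsto_const z] by simp
  qed
  ultimately have "(\<lambda>n. g (l n) (r n)) \<longlonglongrightarrow> G u"
    using assms(2) lr True unfolding grid_limit_def by auto
  then show ?thesis using lr True by simp
next
  case False
  then show ?thesis using grid_step_outside[OF assms(1) False] by simp
qed

lemma grid_step_measurable [measurable]: "grid_step \<tau> n g \<in> borel_measurable borel"
  unfolding grid_step_def by measurable

lemma grid_limit_measurable:
  assumes "0 < \<tau>" "grid_limit \<tau> g G"
  shows "(\<lambda>u. indicator {0<..\<tau>} u * G u) \<in> borel_measurable borel"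
  by (rule borel_measurable_LIMSEQ_real[OF grid_step_tendsto[OF assms]]) measurable

lemma grid_step_bound:
  assumes "0 < \<tau>" "\<And>l r. 0 \<le> l \<Longrightarrow> l \<le> r \<Longrightarrow> r \<le> \<tau> \<Longrightarrow> \<bar>g l r\<bar> \<le> K"
  shows "\<bar>grid_step \<tau> n g u\<bar> \<le> K * indicator {0<..\<tau>} u"
proof (cases "u \<in> {0<..\<tau>}")
  case True
  then obtain l r where "0 \<le> l" "l < u" "u \<le> r" "r \<le> \<tau>" "grid_step \<tau> n g u = g l r"
    using grid_step_cell[OF assms(1) True, of n] by metis
  then show ?thesis using assms(2)[of l r] True by auto
qed (simp add: grid_step_outside[OF assms(1)])

lemma integral_grid_step:
  assumes "sets \<mu> = sets borel" "emeasure \<mu> {0<..\<tau>} < \<infinity>" "0 < \<tau>"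
  shows "(LINT u|\<mu>. grid_step \<tau> n g u) =
    (\<Sum>i<Suc n. g (grid \<tau> n i) (grid \<tau> n (Suc i)) * measure \<mu> {grid \<tau> n i<..grid \<tau> n (Suc i)})"
    and "integrable \<mu> (grid_step \<tau> n g)"
proof -
  note [measurable_cong] = assms(1)
  have fin: "emeasure \<mu> {grid \<tau> n i<..grid \<tau> n (Suc i)} < \<infinity>" if "i < Suc n" for i
  proof -
    have "{grid \<tau> n i<..grid \<tau> n (Suc i)} \<subseteq> {0<..\<tau>}"
      using grid_cell_subset[OF assms(3) that] by blast
    then show ?thesis using emeasure_mono[of _ "{0<..\<tau>}" \<mu>] assms(1,2) by (metis greaterThanAtMost_borel order_le_less_trans)
  qed
  have I: "integrable \<mu> (\<lambda>u. indicator {grid \<tau> n i<..grid \<tau> n (Suc i)} u * g (grid \<tau> n i) (grid \<tau> n (Suc i)))"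
    if "i \<in> {..<Suc n}" for i
    using fin[of i] that assms(1)
    by (intro integrable_mult_left integrable_real_indicator) auto
  show "integrable \<mu> (grid_step \<tau> n g)"
    unfolding grid_step_def[abs_def] by (intro Bochner_Integration.integrable_sum I)
  have sp: "space \<mu> = UNIV" using sets_eq_imp_space_eq[OF assms(1)] by simp
  show "(LINT u|\<mu>. grid_step \<tau> n g u) =
    (\<Sum>i<Suc n. g (grid \<tau> n i) (grid \<tau> n (Suc i)) * measure \<mu> {grid \<tau> n i<..grid \<tau> n (Suc i)})"
    unfolding grid_step_def
    by (subst Bochner_Integration.integral_sum[OF I], simp, intro sum.cong) (auto simp: sp)
qed

lemma integral_grid_limit:
  assumes mu: "sets \<mu> = sets borel" "emeasure \<mu> {0<..\<tau>} < \<infinity>" and \<tau>: "0 < \<tau>"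
    and lim: "grid_limit \<tau> g G"
    and K: "\<And>l r. 0 \<le> l \<Longrightarrow> l \<le> r \<Longrightarrow> r \<le> \<tau> \<Longrightarrow> \<bar>g l r\<bar> \<le> K"
  shows "set_integrable \<mu> {0<..\<tau>} G"
    and "(\<lambda>n. LINT u|\<mu>. grid_step \<tau> n g u) \<longlonglongrightarrow> (LINT u:{0<..\<tau>}|\<mu>. G u)"
    and "\<bar>LINT u|\<mu>. grid_step \<tau> n g u\<bar> \<le> K * measure \<mu> {0<..\<tau>}"
proof -
  note [measurable_cong] = mu(1)
  have I: "integrable \<mu> (\<lambda>u. K * indicator {0<..\<tau>} u)"
    using mu by (intro integrable_mult_right integrable_real_indicator) auto
  have m: "(\<lambda>u. indicator {0<..\<tau>} u *\<^sub>R G u) \<in> borel_measurable \<mu>"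
    using grid_limit_measurable[OF \<tau> lim] by simp
  have t: "AE u in \<mu>. (\<lambda>n. grid_step \<tau> n g u) \<longlonglongrightarrow> indicator {0<..\<tau>} u *\<^sub>R G u"
    using grid_step_tendsto[OF \<tau> lim] by simp
  have b: "AE u in \<mu>. norm (grid_step \<tau> n g u) \<le> K * indicator {0<..\<tau>} u" for n
    using grid_step_bound[where g = g, OF \<tau> K] by simp
  have s: "grid_step \<tau> n g \<in> borel_measurable \<mu>" for n by measurable
  show "set_integrable \<mu> {0<..\<tau>} G"
    unfolding set_integrable_def by (rule integrable_dominated_convergence[OF m s I t b])
  show "(\<lambda>n. LINT u|\<mu>. grid_step \<tau> n g u) \<longlonglongrightarrow> (LINT u:{0<..\<tau>}|\<mu>. G u)"
    unfolding set_lebesgue_integral_def by (rule integral_dominated_convergence[OF m s I t b])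
  have "norm (LINT u|\<mu>. grid_step \<tau> n g u) \<le> (LINT u|\<mu>. K * indicator {0<..\<tau>} u)"
    by (rule Bochner_Integration.integral_norm_bound_integral)
       (use integral_grid_step(2)[OF mu \<tau>] I grid_step_bound[where g = g, OF \<tau> K] in auto)
  then show "\<bar>LINT u|\<mu>. grid_step \<tau> n g u\<bar> \<le> K * measure \<mu> {0<..\<tau>}"
    using sets_eq_imp_space_eq[OF mu(1)] by simp
qed

lemma expectation_grid_limit:
  fixes g :: "'a \<Rightarrow> real \<Rightarrow> real \<Rightarrow> real" and W :: "'a \<Rightarrow> real"
  assumes \<tau>: "0 < \<tau>" and K0: "0 \<le> K"
    and mu: "\<And>\<omega>. \<omega> \<in> space M \<Longrightarrow> sets (\<mu> \<omega>) = sets borel"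
      "\<And>\<omega>. \<omega> \<in> space M \<Longrightarrow> emeasure (\<mu> \<omega>) {0<..\<tau>} < \<infinity>"
      "\<And>\<omega>. \<omega> \<in> space M \<Longrightarrow> measure (\<mu> \<omega>) {0<..\<tau>} \<le> W \<omega>"
    and W: "integrable M W"
    and nu: "sets \<nu> = sets borel" "emeasure \<nu> {0<..\<tau>} < \<infinity>"
    and lim: "\<And>\<omega>. \<omega> \<in> space M \<Longrightarrow> grid_limit \<tau> (g \<omega>) (G \<omega>)"
    and K: "\<And>\<omega> l r. \<omega> \<in> space M \<Longrightarrow> 0 \<le> l \<Longrightarrow> l \<le> r \<Longrightarrow> r \<le> \<tau> \<Longrightarrow> \<bar>g \<omega> l r\<bar> \<le> K"
    and lim': "grid_limit \<tau> h H"
    and K': "\<And>l r. 0 \<le> l \<Longrightarrow> l \<le> r \<Longrightarrow> r \<le> \<tau> \<Longrightarrow> \<bar>h l r\<bar> \<le> K'"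
    and E: "\<And>l r. 0 \<le> l \<Longrightarrow> l \<le> r \<Longrightarrow> r \<le> \<tau> \<Longrightarrow>
      has_bochner_integral M (\<lambda>\<omega>. g \<omega> l r * measure (\<mu> \<omega>) {l<..r}) (h l r * measure \<nu> {l<..r})"
  shows "(LINT \<omega>|M. (LINT u:{0<..\<tau>}|\<mu> \<omega>. G \<omega> u)) = (LINT u:{0<..\<tau>}|\<nu>. H u)"
proof -
  let ?A = "\<lambda>n \<omega>. LINT u|\<mu> \<omega>. grid_step \<tau> n (g \<omega>) u"
  have hb: "has_bochner_integral M (?A n) (LINT u|\<nu>. grid_step \<tau> n h u)" for n
  proof -
    have "has_bochner_integral M
       (\<lambda>\<omega>. \<Sum>i<Suc n. g \<omega> (grid \<tau> n i) (grid \<tau> n (Suc i)) * measure (\<mu> \<omega>) {grid \<tau> n i<..grid \<tau> n (Suc i)})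
       (\<Sum>i<Suc n. h (grid \<tau> n i) (grid \<tau> n (Suc i)) * measure \<nu> {grid \<tau> n i<..grid \<tau> n (Suc i)})"
      by (intro has_bochner_integral_sum E) (use grid_bounds[OF \<tau>] in auto)
    then show ?thesis
      using integral_grid_step(1)[OF nu \<tau>] integral_grid_step(1)[OF mu(1,2) \<tau>]
      by (simp cong: has_bochner_integral_cong del: sum.lessThan_Suc)
  qed
  have t: "(\<lambda>n. ?A n \<omega>) \<longlonglongrightarrow> (LINT u:{0<..\<tau>}|\<mu> \<omega>. G \<omega> u)" if "\<omega> \<in> space M" for \<omega>
    using integral_grid_limit(2)[OF mu(1,2) \<tau> lim K] that by blast
  have Am: "?A n \<in> borel_measurable M" for n
    using hb by (auto simp: has_bochner_integral_iff)
  have "(\<lambda>n. LINT \<omega>|M. ?A n \<omega>) \<longlonglongrightarrow> (LINT \<omega>|M. (LINT u:{0<..\<tau>}|\<mu> \<omega>. G \<omega> u))"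
  proof (rule integral_dominated_convergence)
    show "(\<lambda>\<omega>. LINT u:{0<..\<tau>}|\<mu> \<omega>. G \<omega> u) \<in> borel_measurable M"
      by (rule borel_measurable_LIMSEQ_real[OF t Am])
    show "integrable M (\<lambda>\<omega>. K * W \<omega>)" using W by simp
    show "AE \<omega> in M. norm (?A n \<omega>) \<le> K * W \<omega>" for n
    proof (rule AE_I2)
      fix \<omega> assume w: "\<omega> \<in> space M"
      have "norm (?A n \<omega>) \<le> K * measure (\<mu> \<omega>) {0<..\<tau>}"
        using integral_grid_limit(3)[OF mu(1,2)[OF w] \<tau> lim[OF w] K[OF w]] by simp
      also have "\<dots> \<le> K * W \<omega>" using mu(3)[OF w] K0 by (rule mult_left_mono)
      finally show "norm (?A n \<omega>) \<le> K * W \<omega>" .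
    qed
  qed (use Am t in auto)
  moreover have "(LINT \<omega>|M. ?A n \<omega>) = (LINT u|\<nu>. grid_step \<tau> n h u)" for n
    using hb by (simp add: has_bochner_integral_iff)
  moreover have "(\<lambda>n. LINT u|\<nu>. grid_step \<tau> n h u) \<longlonglongrightarrow> (LINT u:{0<..\<tau>}|\<nu>. H u)"
    by (rule integral_grid_limit(2)[OF nu \<tau> lim' K'])
  ultimately show ?thesis using LIMSEQ_unique by simp
qed


lemma grid_limit_mult:
  assumes "grid_limit \<tau> g G" "grid_limit \<tau> h H"
  shows "grid_limit \<tau> (\<lambda>l r. g l r * h l r) (\<lambda>u. G u * H u)"
  unfolding grid_limit_def
proof (intro allI impI, elim conjE)
  fix u and l r :: "nat \<Rightarrow> real"
  assume "0 < u" "u \<le> \<tau>" "\<forall>n. 0 \<le> l n \<and> l n < u \<and> u \<le> r n \<and> r n \<le> \<tau>" "l \<longlonglongrightarrow> u" "r \<longlonglongrightarrow> u"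
  then show "(\<lambda>n. g (l n) (r n) * h (l n) (r n)) \<longlonglongrightarrow> G u * H u"
    using assms unfolding grid_limit_def by (intro tendsto_mult) auto
qed

lemma cadlag_sequentially:
  assumes "cadlag T f" "0 \<le> u" "u \<le> T" "\<And>n. u \<le> r n \<and> r n \<le> T" "r \<longlonglongrightarrow> u"
  shows "(\<lambda>n. f (r n)) \<longlonglongrightarrow> f u"
proof (cases "u = T")
  case True
  then have "r n = u" for n using assms(4)[of n] by simp
  then show ?thesis by simp
next
  case False
  then have lim: "(f \<longlongrightarrow> f u) (at_right u)" using assms unfolding cadlag_def by auto
  show ?thesis
  proof (rule metric_LIMSEQ_I)
    fix e :: real assume e: "0 < e"
    from tendstoD[OF lim e] obtain d where d: "0 < d"
      "\<And>v. v \<in> {u<..} \<Longrightarrow> v \<noteq> u \<Longrightarrow> dist v u < d \<Longrightarrow> dist (f v) (f u) < e"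
      unfolding eventually_at by auto
    from metric_LIMSEQ_D[OF assms(5) d(1)] obtain n0 where n0: "\<And>n. n0 \<le> n \<Longrightarrow> dist (r n) u < d"
      by auto
    have "dist (f (r n)) (f u) < e" if "n0 \<le> n" for n
    proof (cases "r n = u")
      case True
      then show ?thesis using e by simp
    next
      case False
      then show ?thesis using d(2)[of "r n"] n0[OF that] assms(4)[of n] by simp
    qed
    then show "\<exists>no. \<forall>n\<ge>no. dist (f (r n)) (f u) < e" by blast
  qed
qed

lemma cadlag_add:
  assumes "cadlag T f" "cadlag T g"
  shows "cadlag T (\<lambda>u. f u + g u)"
  using assms unfolding cadlag_def by (blast intro: tendsto_add)

lemma cadlag_mult:
  assumes "cadlag T f" "cadlag T g"
  shows "cadlag T (\<lambda>u. f u * g u)"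
  using assms unfolding cadlag_def by (blast intro: tendsto_mult)

lemma grid_limit_cadlag:
  assumes "cadlag T f" "\<tau> \<le> T"
  shows "grid_limit \<tau> (\<lambda>l r. f r) f"
  unfolding grid_limit_def
proof (intro allI impI, elim conjE)
  fix u and l r :: "nat \<Rightarrow> real"
  assume "0 < u" "u \<le> \<tau>" "\<forall>n. 0 \<le> l n \<and> l n < u \<and> u \<le> r n \<and> r n \<le> \<tau>" "r \<longlonglongrightarrow> u"
  moreover from this have "u \<le> r n \<and> r n \<le> T" for n using assms(2) by (meson order_trans)
  ultimately show "(\<lambda>n. f (r n)) \<longlonglongrightarrow> f u"
    using assms by - (rule cadlag_sequentially[where T = T], auto)
qed

lemma grid_limit_left:
  assumes "continuous_on {0..\<tau>} f"
  shows "grid_limit \<tau> (\<lambda>l r. f l) f"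
  unfolding grid_limit_def
proof (intro allI impI, elim conjE)
  fix u and l r :: "nat \<Rightarrow> real"
  assume "0 < u" "u \<le> \<tau>" "\<forall>n. 0 \<le> l n \<and> l n < u \<and> u \<le> r n \<and> r n \<le> \<tau>" "l \<longlonglongrightarrow> u"
  moreover from this have "l n \<in> {0..\<tau>}" for n
    by (metis atLeastAtMost_iff less_imp_le order_trans)
  ultimately show "(\<lambda>n. f (l n)) \<longlonglongrightarrow> f u"
    by - (rule continuous_on_tendsto_compose[OF assms], auto)
qed

lemma grid_limit_right:
  assumes "continuous_on {0..\<tau>} f"
  shows "grid_limit \<tau> (\<lambda>l r. f r) f"
  unfolding grid_limit_def
proof (intro allI impI, elim conjE)
  fix u and l r :: "nat \<Rightarrow> real"
  assume *: "0 < u" "u \<le> \<tau>" "\<forall>n. 0 \<le> l n \<and> l n < u \<and> u \<le> r n \<and> r n \<le> \<tau>" "r \<longlonglongrightarrow> u"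
  have "r n \<in> {0..\<tau>}" for n
    using *(1,3) by (metis atLeastAtMost_iff less_imp_le order_trans)
  with * show "(\<lambda>n. f (r n)) \<longlonglongrightarrow> f u"
    by - (rule continuous_on_tendsto_compose[OF assms], auto)
qed

lemma set_integrable_grid:
  assumes "0 < \<tau>" "\<tau> \<le> T" "grid_limit \<tau> g G"
    "\<And>l r. 0 \<le> l \<Longrightarrow> l \<le> r \<Longrightarrow> r \<le> \<tau> \<Longrightarrow> \<bar>g l r\<bar> \<le> B"
  shows "set_integrable lborel {0<..\<tau>} G"
  by (rule integral_grid_limit(1)[OF _ _ assms(1,3,4)]) (use assms in auto)

lemma set_integral_Icc_eq_Ioc:
  fixes f :: "real \<Rightarrow> real"
  assumes "set_integrable lborel {a<..b} f" "a \<le> b"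
  shows "(LINT u:{a..b}|lborel. f u) = (LINT u:{a<..b}|lborel. f u)"
proof -
  have i0: "set_integrable lborel {a} f"
  proof -
    have "(\<lambda>u. indicator {a} u *\<^sub>R f u) = (\<lambda>u. indicator {a} u * f a)"
      by (auto simp: indicator_def fun_eq_iff)
    moreover have "integrable lborel (\<lambda>u. indicator {a} u * f a)"
      by (intro integrable_mult_left integrable_real_indicator) auto
    ultimately show ?thesis by (simp only: set_integrable_def)
  qed
  have "{a..b} = {a} \<union> {a<..b}" using assms(2) by auto
  then have "(LINT u:{a..b}|lborel. f u) = (LINT u:{a}|lborel. f u) + (LINT u:{a<..b}|lborel. f u)"
    using set_integral_Un[OF _ i0 assms(1)] by simp
  also have "(LINT u:{a}|lborel. f u) = 0"
    unfolding set_lebesgue_integral_def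
    by (rule integral_eq_zero_AE)
       (rule AE_mp[OF AE_lborel_singleton[of a]], auto simp: indicator_def)
  finally show ?thesis by simp
qed

definition pois :: "nat \<Rightarrow> real \<Rightarrow> real" where
  "pois k m = m ^ k / fact k * exp (- m)"

definition pois_cdf :: "nat \<Rightarrow> real \<Rightarrow> real" where
  "pois_cdf x m = (\<Sum>k\<le>x. pois k m)"

lemma pois_nonneg: "0 \<le> m \<Longrightarrow> 0 \<le> pois k m"
  by (simp add: pois_def)

lemma pois_cdf_nonneg: "0 \<le> m \<Longrightarrow> 0 \<le> pois_cdf x m"
  by (simp add: pois_cdf_def sum_nonneg pois_nonneg)

lemma continuous_on_pois: "continuous_on A f \<Longrightarrow> continuous_on A (\<lambda>u. pois k (f u))"
  unfolding pois_def by (intro continuous_intros) auto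

lemma continuous_on_pois_cdf: "continuous_on A f \<Longrightarrow> continuous_on A (\<lambda>u. pois_cdf k (f u))"
  unfolding pois_cdf_def by (intro continuous_on_sum continuous_on_pois)

lemma exp_series_sums: "(\<lambda>k. m ^ k / fact k) sums exp (m::real)"
  using exp_converges[of m] by (simp add: field_simps scaleR_conv_of_real)

lemma pois_sums: "(\<lambda>k. pois k m) sums 1"
  using sums_mult2[OF exp_series_sums[of m], of "exp (- m)"]
  by (simp add: pois_def exp_minus_inverse)

lemma pois_cdf_tendsto: "(\<lambda>x. pois_cdf x m) \<longlonglongrightarrow> 1"
  using pois_sums[of m] unfolding pois_cdf_def sums_def_le .

lemma pois_Suc: "real (Suc k) * pois (Suc k) m = m * pois k m"
proof -
  have "real (Suc k) * (m ^ Suc k / fact (Suc k)) = m * (m ^ k / fact k)"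
    unfolding fact_Suc by (simp del: of_nat_Suc)
  then show ?thesis
    by (simp only: pois_def mult.assoc[symmetric])
qed

lemma pois_mean_sums: "(\<lambda>k. real k * pois k m) sums m"
proof -
  have "(\<lambda>k. real (Suc k) * pois (Suc k) m) = (\<lambda>k. m * pois k m)"
    by (simp only: pois_Suc)
  then have "(\<lambda>k. real (Suc k) * pois (Suc k) m) sums m"
    using sums_mult[OF pois_sums[of m], of m] by simp
  then show ?thesis using sums_Suc[of "\<lambda>k. real k * pois k m" m] by simp
qed

lemma pois_cdf_le_pois:
  assumes "0 \<le> m"
  shows "pois_cdf x m * (m - real x) \<le> m * pois x m"
proof (induction x)
  case 0
  then show ?case by (simp add: pois_cdf_def)
next
  case (Suc x)
  have e: "m * pois x m = real (Suc x) * pois (Suc x) m"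
    by (simp only: pois_Suc)
  have "pois_cdf x m * (m - real (Suc x)) \<le> real (Suc x) * pois (Suc x) m"
    using Suc e pois_cdf_nonneg[OF assms, of x] by (simp add: algebra_simps)
  then show ?case by (simp add: pois_cdf_def algebra_simps)
qed

lemma (in prob_space) poisson_expectation:
  assumes X: "X \<in> M \<rightarrow>\<^sub>M count_space UNIV" and r: "0 \<le> r"
    and d: "\<And>k. prob {\<omega>\<in>space M. X \<omega> = k} = pois k r"
  shows "has_bochner_integral M (\<lambda>\<omega>. real (X \<omega>)) r"
proof (rule has_bochner_integral_nn_integral)
  note [measurable] = X
  show "(\<lambda>\<omega>. real (X \<omega>)) \<in> borel_measurable M" by measurable
  have "(\<integral>\<^sup>+ \<omega>. ennreal (real (X \<omega>)) \<partial>M) =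
      (\<integral>\<^sup>+ \<omega>. (\<Sum>k. ennreal (real k) * indicator {\<omega>\<in>space M. X \<omega> = k} \<omega>) \<partial>M)"
  proof (rule nn_integral_cong)
    fix \<omega> assume "\<omega> \<in> space M"
    then have "(\<Sum>k. ennreal (real k) * indicator {\<omega>\<in>space M. X \<omega> = k} \<omega>) =
        (\<Sum>k\<in>{X \<omega>}. ennreal (real k) * indicator {\<omega>\<in>space M. X \<omega> = k} \<omega>)"
      by (intro suminf_finite) auto
    with \<open>\<omega> \<in> space M\<close> show "ennreal (real (X \<omega>)) =
        (\<Sum>k. ennreal (real k) * indicator {\<omega>\<in>space M. X \<omega> = k} \<omega>)"
      by simp
  qed
  also have "\<dots> = (\<Sum>k. \<integral>\<^sup>+ \<omega>. ennreal (real k) * indicator {\<omega>\<in>space M. X \<omega> = k} \<omega> \<partial>M)"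
    by (rule nn_integral_suminf) measurable
  also have "\<dots> = (\<Sum>k. ennreal (real k * pois k r))"
    by (simp add: nn_integral_cmult emeasure_eq_measure d ennreal_mult pois_nonneg r)
  also have "\<dots> = ennreal r"
    by (rule suminf_ennreal_eq[OF _ pois_mean_sums]) (simp add: pois_nonneg r)
  finally show "(\<integral>\<^sup>+ \<omega>. ennreal (real (X \<omega>)) \<partial>M) = ennreal r" .
qed (use r in auto)

locale nh_poisson = prob_space M for M :: "'a measure" +
  fixes T :: real and lam :: "real \<Rightarrow> real" and N :: "real \<Rightarrow> 'a \<Rightarrow> nat"
  assumes T_pos: "0 < T"
    and lam_nonneg: "\<And>t. t \<in> {0..T} \<Longrightarrow> 0 \<le> lam t"
    and lam_cadlag: "cadlag T lam"
    and lam_antimono: "antimono_on {0..T} lam"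
    and process: "nh_poisson_process M T lam N"
begin

abbreviation L :: "real \<Rightarrow> real" where "L \<equiv> cum_intensity lam"

definition intensity_measure :: "real measure" where
  "intensity_measure = density lborel (\<lambda>u. ennreal (indicator {0<..T} u * lam u))"

lemma lam_le: "t \<in> {0..T} \<Longrightarrow> lam t \<le> lam 0"
  using monotone_onD[OF lam_antimono, of 0 t] by auto

lemma lam_integrable: "integrable lborel (\<lambda>u. indicator {0<..T} u * lam u)"
proof -
  have "set_integrable lborel {0<..T} lam"
  proof (rule integral_grid_limit(1)[OF _ _ T_pos grid_limit_cadlag[OF lam_cadlag order.refl]])
    show "\<bar>lam r\<bar> \<le> lam 0" if "0 \<le> l" "l \<le> r" "r \<le> T" for l r
      using lam_le[of r] lam_nonneg[of r] that by auto
  qed (use T_pos in auto)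
  then show ?thesis by (simp add: set_integrable_def)
qed

lemma set_integrable_lam: "A \<subseteq> {0<..T} \<Longrightarrow> A \<in> sets borel \<Longrightarrow> set_integrable lborel A lam"
  by (rule set_integrable_subset[of lborel "{0<..T}"]) (use lam_integrable in \<open>auto simp: set_integrable_def\<close>)

lemma L_eq:
  assumes "0 \<le> t" "t \<le> T"
  shows "L t = (LINT u:{0<..t}|lborel. lam u)"
  unfolding cum_intensity_def using assms
  by (intro set_integral_Icc_eq_Ioc set_integrable_lam) auto

lemma L_diff:
  assumes "0 \<le> s" "s \<le> t" "t \<le> T"
  shows "L t - L s = (LINT u:{s<..t}|lborel. lam u)"
proof -
  have "{0<..t} = {0<..s} \<union> {s<..t}" using assms by auto
  then have "(LINT u:{0<..t}|lborel. lam u) = (LINT u:{0<..s}|lborel. lam u) + (LINT u:{s<..t}|lborel. lam u)"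
    using assms by (simp only:, intro set_integral_Un set_integrable_lam) auto
  then show ?thesis using assms by (simp add: L_eq)
qed

lemma L_0 [simp]: "L 0 = 0"
  using L_eq[of 0] T_pos by (simp add: set_lebesgue_integral_def)

lemma L_diff_bounds:
  assumes "0 \<le> s" "s \<le> t" "t \<le> T"
  shows "0 \<le> L t - L s" "L t - L s \<le> lam 0 * (t - s)"
proof -
  show "0 \<le> L t - L s"
    unfolding L_diff[OF assms] set_lebesgue_integral_def
    using assms lam_nonneg by (intro Bochner_Integration.integral_nonneg) (auto simp: indicator_def)
  have "(LINT u:{s<..t}|lborel. lam u) \<le> (LINT u:{s<..t}|lborel. lam 0)"
    using assms by (intro set_integral_mono set_integrable_lam lam_le) (auto simp: set_integrable_def)
  then show "L t - L s \<le> lam 0 * (t - s)"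
    unfolding L_diff[OF assms] using assms by (simp add: set_lebesgue_integral_def mult.commute)
qed

lemma L_nonneg: "0 \<le> t \<Longrightarrow> t \<le> T \<Longrightarrow> 0 \<le> L t"
  using L_diff_bounds(1)[of 0 t] by simp

lemma L_mono: "0 \<le> s \<Longrightarrow> s \<le> t \<Longrightarrow> t \<le> T \<Longrightarrow> L s \<le> L t"
  using L_diff_bounds(1)[of s t] by simp

lemma continuous_on_L:
  assumes "\<tau> \<le> T"
  shows "continuous_on {0..\<tau>} L"
proof (rule continuous_on_subset[of "{0..T}"])
  have "dist (L s) (L t) \<le> lam 0 * dist s t" if "s \<in> {0..T}" "t \<in> {0..T}" for s t
    using L_diff_bounds[of s t] L_diff_bounds[of t s] that
    by (cases "s \<le> t") (auto simp: dist_real_def abs_if algebra_simps)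
  then have "(lam 0)-lipschitz_on {0..T} L"
    using lam_nonneg[of 0] T_pos by (intro lipschitz_onI) auto
  then show "continuous_on {0..T} L" by (rule lipschitz_on_continuous_on)
qed (use assms in auto)

lemma sets_intensity_measure [simp]: "sets intensity_measure = sets borel"
  by (simp add: intensity_measure_def)

lemma emeasure_intensity_measure:
  assumes "0 \<le> s" "s \<le> t" "t \<le> T"
  shows "emeasure intensity_measure {s<..t} = ennreal (L t - L s)"
proof -
  have m: "(\<lambda>u. ennreal (indicator {0<..T} u * lam u)) \<in> borel_measurable lborel"
    using measurable_compose[OF borel_measurable_integrable[OF lam_integrable] measurable_ennreal] .
  have "emeasure intensity_measure {s<..t} =
      (\<integral>\<^sup>+u. ennreal (indicator {0<..T} u * lam u) * indicator {s<..t} u \<partial>lborel)"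
    unfolding intensity_measure_def by (rule emeasure_density[OF m]) simp
  also have "\<dots> = (\<integral>\<^sup>+u. ennreal (indicator {s<..t} u *\<^sub>R lam u) \<partial>lborel)"
    using assms by (intro nn_integral_cong) (auto simp: indicator_def)
  also have "\<dots> = ennreal (LINT u|lborel. indicator {s<..t} u *\<^sub>R lam u)"
  proof (rule nn_integral_eq_integral)
    show "integrable lborel (\<lambda>u. indicator {s<..t} u *\<^sub>R lam u)"
      by (rule set_integrable_lam[unfolded set_integrable_def]) (use assms in auto)
  qed (use assms lam_nonneg in \<open>auto simp: indicator_def\<close>)
  finally show ?thesis using L_diff[OF assms] by (simp add: set_lebesgue_integral_def)
qed

lemma measure_intensity_measure:
  assumes "0 \<le> s" "s \<le> t" "t \<le> T"
  shows "measure intensity_measure {s<..t} = L t - L s"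
  using emeasure_intensity_measure[OF assms] L_diff_bounds(1)[OF assms] by (simp add: measure_def)

lemma integral_intensity_measure:
  assumes "0 < \<tau>" "\<tau> \<le> T" "(\<lambda>u. indicator {0<..\<tau>} u * G u) \<in> borel_measurable borel"
  shows "(LINT u:{0<..\<tau>}|intensity_measure. G u) = (LINT u:{0<..\<tau>}|lborel. lam u * G u)"
proof -
  have "(LINT u:{0<..\<tau>}|intensity_measure. G u) =
      (LINT u|lborel. (indicator {0<..T} u * lam u) * (indicator {0<..\<tau>} u * G u))"
    unfolding intensity_measure_def set_lebesgue_integral_def
    using lam_integrable assms(3) lam_nonneg
    by (subst integral_real_density) (auto simp: indicator_def)
  also have "\<dots> = (LINT u:{0<..\<tau>}|lborel. lam u * G u)"
    unfolding set_lebesgue_integral_def using assms(2)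
    by (intro Bochner_Integration.integral_cong) (auto simp: indicator_def)
  finally show ?thesis .
qed

lemma N_measurable [measurable]: "0 \<le> t \<Longrightarrow> t \<le> T \<Longrightarrow> N t \<in> M \<rightarrow>\<^sub>M count_space UNIV"
  using process by (simp add: nh_poisson_process_def)

lemma N_mono: "\<omega> \<in> space M \<Longrightarrow> 0 \<le> s \<Longrightarrow> s \<le> t \<Longrightarrow> t \<le> T \<Longrightarrow> N s \<omega> \<le> N t \<omega>"
  using process by (auto simp: nh_poisson_process_def mono_on_def)

lemma N_0: "\<omega> \<in> space M \<Longrightarrow> N 0 \<omega> = 0"
  using process by (auto simp: nh_poisson_process_def)

lemma N_cadlag: "\<omega> \<in> space M \<Longrightarrow> cadlag T (\<lambda>t. real (N t \<omega>))"
  using process by (auto simp: nh_poisson_process_def)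

lemma prob_increment:
  assumes "0 \<le> s" "s \<le> t" "t \<le> T"
  shows "prob {\<omega>\<in>space M. N t \<omega> - N s \<omega> = k} = pois k (L t - L s)"
  using process assms by (simp add: nh_poisson_process_def pois_def)

lemma prob_eq:
  assumes "0 \<le> t" "t \<le> T"
  shows "prob {\<omega>\<in>space M. N t \<omega> = k} = pois k (L t)"
proof -
  have "{\<omega>\<in>space M. N t \<omega> = k} = {\<omega>\<in>space M. N t \<omega> - N 0 \<omega> = k}"
    using N_0 by auto
  then show ?thesis using prob_increment[of 0 t k] assms by simp
qed

lemma prob_le:
  assumes "0 \<le> t" "t \<le> T"
  shows "prob {\<omega>\<in>space M. N t \<omega> \<le> x} = pois_cdf x (L t)"
proof -
  note [measurable] = N_measurable[OF assms]
  have "{\<omega>\<in>space M. N t \<omega> \<le> x} = (\<Union>k\<in>{..x}. {\<omega>\<in>space M. N t \<omega> = k})" by auto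
  then have "prob {\<omega>\<in>space M. N t \<omega> \<le> x} = (\<Sum>k\<le>x. prob {\<omega>\<in>space M. N t \<omega> = k})"
    by (simp only:, intro finite_measure_finite_Union) (auto simp: disjoint_family_on_def)
  then show ?thesis using prob_eq[OF assms] by (simp add: pois_cdf_def)
qed

lemma prob_ge:
  assumes "0 \<le> t" "t \<le> T"
  shows "prob {\<omega>\<in>space M. x \<le> N t \<omega>} = 1 - (\<Sum>k<x. pois k (L t))"
proof (cases x)
  case 0
  then show ?thesis by (simp add: prob_space)
next
  case (Suc y)
  note [measurable] = N_measurable[OF assms]
  have "{\<omega>\<in>space M. x \<le> N t \<omega>} = space M - {\<omega>\<in>space M. N t \<omega> \<le> y}" using Suc by auto
  then show ?thesis
    using prob_compl[of "{\<omega>\<in>space M. N t \<omega> \<le> y}"] prob_le[OF assms, of y] Suc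
    by (simp add: pois_cdf_def lessThan_Suc_atMost)
qed

lemma pois_L_bounds:
  assumes "0 \<le> t" "t \<le> T"
  shows "0 \<le> pois x (L t)" "pois x (L t) \<le> 1"
  using prob_eq[OF assms, of x] by (metis measure_nonneg) (metis prob_eq[OF assms, of x] prob_le_1)

lemma pois_cdf_L_antimono:
  assumes "0 \<le> s" "s \<le> t" "t \<le> T"
  shows "pois_cdf x (L t) \<le> pois_cdf x (L s)"
proof -
  have [measurable]: "N s \<in> M \<rightarrow>\<^sub>M count_space UNIV" "N t \<in> M \<rightarrow>\<^sub>M count_space UNIV"
    using assms by (auto intro: N_measurable)
  have "prob {\<omega>\<in>space M. N t \<omega> \<le> x} \<le> prob {\<omega>\<in>space M. N s \<omega> \<le> x}"
  proof (rule finite_measure_mono)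
    show "{\<omega>\<in>space M. N t \<omega> \<le> x} \<subseteq> {\<omega>\<in>space M. N s \<omega> \<le> x}"
      using N_mono[OF _ assms] by (auto intro: order.trans)
    show "{\<omega>\<in>space M. N s \<omega> \<le> x} \<in> events"
      by measurable
  qed
  then show ?thesis using prob_le assms by simp
qed

lemma pois_cdf_L_bounds:
  assumes "0 \<le> t" "t \<le> T"
  shows "0 \<le> pois_cdf x (L t)" "pois_cdf x (L t) \<le> 1"
  using prob_le[OF assms, of x] by (metis measure_nonneg) (metis prob_le[OF assms, of x] prob_le_1)

lemma increment_expectation:
  assumes "0 \<le> s" "s \<le> t" "t \<le> T"
  shows "has_bochner_integral M (\<lambda>\<omega>. real (N t \<omega>) - real (N s \<omega>)) (L t - L s)"
proof -
  have [measurable]: "N s \<in> M \<rightarrow>\<^sub>M count_space UNIV" "N t \<in> M \<rightarrow>\<^sub>M count_space UNIV"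
    using assms by (auto intro: N_measurable)
  have "has_bochner_integral M (\<lambda>\<omega>. real (N t \<omega> - N s \<omega>)) (L t - L s)"
  proof (rule poisson_expectation)
    show "(\<lambda>\<omega>. N t \<omega> - N s \<omega>) \<in> M \<rightarrow>\<^sub>M count_space UNIV"
      by measurable
  qed (use L_diff_bounds(1)[OF assms] prob_increment[OF assms] in auto)
  then show ?thesis
    by (rule has_bochner_integral_cong[THEN iffD1, rotated 3]) (use N_mono assms in \<open>auto simp: of_nat_diff\<close>)
qed

lemma integrable_N: "0 \<le> t \<Longrightarrow> t \<le> T \<Longrightarrow> integrable M (\<lambda>\<omega>. real (N t \<omega>))"
  by (rule Bochner_Integration.integrable_cong[THEN iffD1, OF refl _ has_bochner_integral_iff[THEN iffD1, THEN conjunct1,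
        OF increment_expectation[of 0 t]]]) (auto simp: N_0)

lemma expectation_ge_increment:
  assumes "0 \<le> s" "s \<le> t" "t \<le> T"
  shows "has_bochner_integral M
    (\<lambda>\<omega>. of_bool (x \<le> N s \<omega>) * (real (N t \<omega>) - real (N s \<omega>)))
    ((1 - (\<Sum>k<x. pois k (L s))) * (L t - L s))"
proof -
  have [measurable]: "N s \<in> M \<rightarrow>\<^sub>M count_space UNIV" "N t \<in> M \<rightarrow>\<^sub>M count_space UNIV"
    using assms by (auto intro: N_measurable)
  define p where "p = (\<lambda>i::nat. if i = 0 then 0 else if i = 1 then s else t)"
  define Y where "Y = (\<lambda>(i::nat) z::real. if i = 0 then of_bool (real x \<le> z) else z)"
  define X where "X = (\<lambda>i \<omega>. real (N (p (Suc i)) \<omega>) - real (N (p i) \<omega>))"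
  have I2: "{..<2} = {0, Suc 0}" by auto
  have "indep_vars (\<lambda>_. borel) X {..<2}"
  proof -
    have "0 \<le> p 0 \<and> (\<forall>i<2. p i \<le> p (Suc i)) \<and> p 2 \<le> T"
      using assms by (auto simp: p_def less_2_cases_iff)
    then show ?thesis using process unfolding nh_poisson_process_def X_def by blast
  qed
  then have ind: "indep_vars (\<lambda>_. borel) (\<lambda>i \<omega>. Y i (X i \<omega>)) {..<2}"
    by (rule indep_vars_compose2) (auto simp: Y_def)
  have X0: "Y 0 (X 0 \<omega>) = of_bool (x \<le> N s \<omega>)" "Y (Suc 0) (X (Suc 0) \<omega>) = real (N t \<omega>) - real (N s \<omega>)"
    if "\<omega> \<in> space M" for \<omega>
    using N_0[OF that] by (auto simp: Y_def X_def p_def)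
  have hb0: "has_bochner_integral M (\<lambda>\<omega>. Y 0 (X 0 \<omega>)) (1 - (\<Sum>k<x. pois k (L s)))"
  proof -
    have "has_bochner_integral M (indicator {\<omega>\<in>space M. x \<le> N s \<omega>}) (prob {\<omega>\<in>space M. x \<le> N s \<omega>} :: real)"
      using assms by (intro has_bochner_integral_real_indicator) (auto simp: emeasure_eq_measure)
    moreover have "prob {\<omega>\<in>space M. x \<le> N s \<omega>} = 1 - (\<Sum>k<x. pois k (L s))"
      using assms by (intro prob_ge) auto
    ultimately show ?thesis
      by (subst has_bochner_integral_cong[OF refl _ refl]) (auto simp: X0 indicator_def)
  qed
  have hb1: "has_bochner_integral M (\<lambda>\<omega>. Y (Suc 0) (X (Suc 0) \<omega>)) (L t - L s)"
    using increment_expectation[OF assms]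
    by (rule has_bochner_integral_cong[THEN iffD1, rotated 3]) (auto simp: X0)
  have int: "integrable M (\<lambda>\<omega>. Y i (X i \<omega>))" if "i \<in> {..<2}" for i
    using that hb0 hb1 unfolding I2 by (auto simp: has_bochner_integral_iff)
  have "has_bochner_integral M (\<lambda>\<omega>. \<Prod>i<2. Y i (X i \<omega>)) (\<Prod>i<2. expectation (\<lambda>\<omega>. Y i (X i \<omega>)))"
    unfolding has_bochner_integral_iff
    using indep_vars_lebesgue_integral[OF _ ind int] indep_vars_integrable[OF _ ind int] by simp
  moreover have "(\<Prod>i<2. expectation (\<lambda>\<omega>. Y i (X i \<omega>))) = (1 - (\<Sum>k<x. pois k (L s))) * (L t - L s)"
    using hb0 hb1 unfolding I2 by (simp add: has_bochner_integral_iff)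
  ultimately show ?thesis
    by (subst has_bochner_integral_cong[OF refl _ refl, where g = "\<lambda>\<omega>. \<Prod>i<2. Y i (X i \<omega>)"])
       (auto simp: I2 X0)
qed

lemma expectation_pos_part:
  assumes "0 \<le> t" "t \<le> T"
  shows "has_bochner_integral M (\<lambda>\<omega>. max (real x - real (N t \<omega>)) 0) (\<Sum>k<x. pois_cdf k (L t))"
proof -
  note [measurable] = N_measurable[OF assms]
  have eq: "max (real x - real n) 0 = (\<Sum>k<x. of_bool (n \<le> k))" for n
    by (induction x) (auto simp: max_def simp del: sum_of_bool_eq split: if_splits)
  have "has_bochner_integral M (\<lambda>\<omega>. of_bool (N t \<omega> \<le> k)) (pois_cdf k (L t))" for k
  proof -
    have "has_bochner_integral M (indicator {\<omega>\<in>space M. N t \<omega> \<le> k}) (prob {\<omega>\<in>space M. N t \<omega> \<le> k} :: real)"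
      by (intro has_bochner_integral_real_indicator) (auto simp: emeasure_eq_measure)
    then show ?thesis
      unfolding prob_le[OF assms]
      by (rule has_bochner_integral_cong[THEN iffD1, rotated 3]) (auto simp: indicator_def)
  qed
  then show ?thesis unfolding eq by (intro has_bochner_integral_sum)
qed

lemma grid_limit_hitting_time:
  assumes "\<omega> \<in> space M" "\<tau> \<le> T"
  shows "grid_limit \<tau> (\<lambda>l r. of_bool (x \<le> N l \<omega>)) (\<lambda>u. of_bool (hitting_time T N x \<omega> < ereal u))"
  unfolding grid_limit_def
proof (intro allI impI, elim conjE)
  fix u and l r :: "nat \<Rightarrow> real"
  assume u: "0 < u" "u \<le> \<tau>" and lr: "\<forall>n. 0 \<le> l n \<and> l n < u \<and> u \<le> r n \<and> r n \<le> \<tau>" and l: "l \<longlonglongrightarrow> u"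
  have hit: "hitting_time T N x \<omega> < ereal u \<longleftrightarrow> (\<exists>v. 0 < v \<and> v < u \<and> x \<le> N v \<omega>)"
    using u assms(2) unfolding hitting_time_def Inf_less_iff by fastforce
  show "(\<lambda>n. of_bool (x \<le> N (l n) \<omega>)) \<longlonglongrightarrow> (of_bool (hitting_time T N x \<omega> < ereal u) :: real)"
  proof (cases "hitting_time T N x \<omega> < ereal u")
    case True
    then obtain v where v: "0 < v" "v < u" "x \<le> N v \<omega>" using hit by auto
    have "\<forall>\<^sub>F n in sequentially. v < l n" using order_tendstoD(1)[OF l v(2)] .
    then have "\<forall>\<^sub>F n in sequentially. of_bool (x \<le> N (l n) \<omega>) = (1::real)"
    proof eventually_elim
      case (elim n)
      have "l n \<le> T" using lr u assms(2) by (meson less_imp_le order_trans)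
      then have "N v \<omega> \<le> N (l n) \<omega>" using elim v N_mono[OF assms(1), of v "l n"] by simp
      then show ?case using v by simp
    qed
    then show ?thesis using True by (simp add: tendsto_eventually)
  next
    case False
    have "\<not> x \<le> N (l n) \<omega>" for n
    proof
      assume x: "x \<le> N (l n) \<omega>"
      define v where "v = (l n + u) / 2"
      have v: "l n < v" "v < u" "0 < v" "v \<le> T" "0 \<le> l n"
        using lr[rule_format, of n] u assms(2) by (auto simp: v_def)
      then have "x \<le> N v \<omega>" using x N_mono[OF assms(1), of "l n" v] by simp
      then show False using False hit v by auto
    qed
    then show ?thesis using False by simp
  qed
qed

lemma emeasure_path_measure:
  assumes w: "\<omega> \<in> space M" and "0 \<le> s" "s \<le> t" "t \<le> T"
  shows "emeasure (path_measure T N \<omega>) {s<..t} = ennreal (real (N t \<omega>) - real (N s \<omega>))"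
proof -
  let ?c = "\<lambda>t. max 0 (min T t)"
  let ?F = "\<lambda>t. real (N (?c t) \<omega>)"
  have "emeasure (interval_measure ?F) {s<..t} = ennreal (?F t - ?F s)"
  proof (rule emeasure_interval_measure_Ioc[OF assms(3)])
    show "?F x \<le> ?F y" if "x \<le> y" for x y
      using that T_pos by (intro of_nat_mono N_mono[OF w]) auto
    show "continuous (at_right a) ?F" for a
    proof -
      consider "a < 0" | "0 \<le> a" "a < T" | "T \<le> a" by linarith
      then have "(?F \<longlongrightarrow> ?F a) (at_right a)"
      proof cases
        case 1
        then have "\<forall>\<^sub>F v in at_right a. ?F v = ?F a"
          using eventually_at_right_real[OF 1] by (auto elim!: eventually_mono)
        then show ?thesis by (rule tendsto_eventually)
      next
        case 2
        then have "((\<lambda>t. real (N t \<omega>)) \<longlongrightarrow> ?F a) (at_right a)"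
          using N_cadlag[OF w] by (auto simp: cadlag_def)
        moreover have "\<forall>\<^sub>F v in at_right a. real (N v \<omega>) = ?F v"
          using eventually_at_right_real[OF 2(2)] 2(1) by (auto elim!: eventually_mono)
        ultimately show ?thesis by (rule Lim_transform_eventually)
      next
        case 3
        then have "\<forall>\<^sub>F v in at_right a. ?F v = ?F a"
          using eventually_at_right_less[of a] by (auto elim!: eventually_mono)
        then show ?thesis by (rule tendsto_eventually)
      qed
      then show ?thesis by (simp add: continuous_within)
    qed
  qed
  then show ?thesis using assms by (simp add: path_measure_def)
qed

lemma measure_path_measure:
  assumes "\<omega> \<in> space M" "0 \<le> s" "s \<le> t" "t \<le> T"
  shows "measure (path_measure T N \<omega>) {s<..t} = real (N t \<omega>) - real (N s \<omega>)"
  using emeasure_path_measure[OF assms] N_mono[OF assms] by (simp add: measure_def)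

lemma expectation_holding_integral:
  assumes \<tau>: "0 < \<tau>" "\<tau> \<le> T" and f: "cadlag T f" "\<And>t. t \<in> {0..T} \<Longrightarrow> \<bar>f t\<bar> \<le> K"
  shows "(LINT \<omega>|M. (LINT u:{0..\<tau>}|lborel. f u * max (real x - real (N u \<omega>)) 0)) =
    (LINT u:{0<..\<tau>}|lborel. f u * (\<Sum>k<x. pois_cdf k (L u)))"
proof -
  let ?g = "\<lambda>\<omega> l r. f r * max (real x - real (N r \<omega>)) 0"
  let ?h = "\<lambda>l r. f r * (\<Sum>k<x. pois_cdf k (L r))"
  have K0: "0 \<le> K" using f(2)[of 0] T_pos by (auto intro: order_trans[OF abs_ge_zero])
  have lim: "grid_limit \<tau> (?g \<omega>) (\<lambda>u. f u * max (real x - real (N u \<omega>)) 0)" if w: "\<omega> \<in> space M" for \<omega>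
  proof (rule grid_limit_mult[OF grid_limit_cadlag[OF f(1) \<tau>(2)]])
    show "grid_limit \<tau> (\<lambda>l r. max (real x - real (N r \<omega>)) 0) (\<lambda>u. max (real x - real (N u \<omega>)) 0)"
      using grid_limit_cadlag[OF N_cadlag[OF w] \<tau>(2)] unfolding grid_limit_def
      by (auto intro!: tendsto_intros)
  qed
  have bound: "\<bar>?g \<omega> l r\<bar> \<le> K * real x" if "0 \<le> l" "l \<le> r" "r \<le> \<tau>" for \<omega> l r
    using f(2)[of r] that \<tau> K0 unfolding abs_mult by (intro mult_mono) auto
  have "(LINT \<omega>|M. (LINT u:{0<..\<tau>}|lborel. f u * max (real x - real (N u \<omega>)) 0)) =
    (LINT u:{0<..\<tau>}|lborel. f u * (\<Sum>k<x. pois_cdf k (L u)))"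
  proof (rule expectation_grid_limit[where g = ?g and h = ?h and W = "\<lambda>_. \<tau>" and K = "K * real x" and K' = "K * real x"])
    show "grid_limit \<tau> ?h (\<lambda>u. f u * (\<Sum>k<x. pois_cdf k (L u)))"
      by (intro grid_limit_mult grid_limit_cadlag[OF f(1) \<tau>(2)] grid_limit_right
          continuous_on_sum continuous_on_pois_cdf continuous_on_L \<tau>(2))
    show "\<bar>?h l r\<bar> \<le> K * real x" if "0 \<le> l" "l \<le> r" "r \<le> \<tau>" for l r
    proof -
      have "0 \<le> (\<Sum>k<x. pois_cdf k (L r))" using pois_cdf_L_bounds that \<tau> by (intro sum_nonneg) auto
      moreover have "(\<Sum>k<x. pois_cdf k (L r)) \<le> of_nat (card {..<x}) * 1"
        using pois_cdf_L_bounds that \<tau> by (intro sum_bounded_above) auto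
      ultimately show ?thesis
        using f(2)[of r] that \<tau> K0 unfolding abs_mult by (intro mult_mono) auto
    qed
    show "has_bochner_integral M (\<lambda>\<omega>. ?g \<omega> l r * measure lborel {l<..r}) (?h l r * measure lborel {l<..r})"
      if "0 \<le> l" "l \<le> r" "r \<le> \<tau>" for l r
      using that \<tau> by (intro has_bochner_integral_mult_left has_bochner_integral_mult_right expectation_pos_part) auto
  qed (use \<tau> K0 lim bound in auto)
  moreover have "(LINT u:{0..\<tau>}|lborel. f u * max (real x - real (N u \<omega>)) 0) =
      (LINT u:{0<..\<tau>}|lborel. f u * max (real x - real (N u \<omega>)) 0)" if "\<omega> \<in> space M" for \<omega>
    using \<tau> integral_grid_limit(1)[OF _ _ \<tau>(1) lim[OF that] bound, of lborel]
    by (intro set_integral_Icc_eq_Ioc) auto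
  ultimately show ?thesis by (simp cong: Bochner_Integration.integral_cong)
qed

lemma tail_bounds:
  assumes "0 \<le> t" "t \<le> T"
  shows "\<bar>1 - (\<Sum>k<x. pois k (L t))\<bar> \<le> 1"
  using measure_nonneg[of M] prob_le_1 prob_ge[OF assms, of x] by (metis abs_of_nonneg)

lemma expectation_path_integral:
  assumes \<tau>: "0 < \<tau>" "\<tau> \<le> T" and f: "cadlag T f" "\<And>t. t \<in> {0..T} \<Longrightarrow> \<bar>f t\<bar> \<le> K"
  shows "(LINT \<omega>|M. (LINT u:{u. min (ereal \<tau>) (hitting_time T N x \<omega>) < ereal u \<and> u \<le> \<tau>}|path_measure T N \<omega>. f u)) =
    (LINT u:{0<..\<tau>}|lborel. lam u * (f u * (1 - (\<Sum>k<x. pois k (L u)))))"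
proof -
  let ?g = "\<lambda>\<omega> l r. f r * of_bool (x \<le> N l \<omega>)"
  let ?h = "\<lambda>l r. f r * (1 - (\<Sum>k<x. pois k (L l)))"
  have K0: "0 \<le> K" using f(2)[of 0] T_pos by (auto intro: order_trans[OF abs_ge_zero])
  have lim: "grid_limit \<tau> ?h (\<lambda>u. f u * (1 - (\<Sum>k<x. pois k (L u))))"
    by (intro grid_limit_mult grid_limit_cadlag[OF f(1) \<tau>(2)] grid_limit_left
          continuous_on_sum continuous_on_pois continuous_on_diff continuous_on_const continuous_on_L \<tau>(2))
  have "(LINT \<omega>|M. (LINT u:{u. min (ereal \<tau>) (hitting_time T N x \<omega>) < ereal u \<and> u \<le> \<tau>}|path_measure T N \<omega>. f u)) =
     (LINT \<omega>|M. (LINT u:{0<..\<tau>}|path_measure T N \<omega>. f u * of_bool (hitting_time T N x \<omega> < ereal u)))"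
  proof (rule Bochner_Integration.integral_cong[OF refl])
    fix \<omega>
    have "0 \<le> hitting_time T N x \<omega>"
      unfolding hitting_time_def by (rule Inf_greatest) auto
    then have "u \<in> {u. min (ereal \<tau>) (hitting_time T N x \<omega>) < ereal u \<and> u \<le> \<tau>} \<longleftrightarrow>
        u \<in> {0<..\<tau>} \<and> hitting_time T N x \<omega> < ereal u" for u
      using \<tau> by (auto simp: min_less_iff_disj) (metis ereal_less(2) order_le_less_trans)
    then show "(LINT u:{u. min (ereal \<tau>) (hitting_time T N x \<omega>) < ereal u \<and> u \<le> \<tau>}|path_measure T N \<omega>. f u) =
       (LINT u:{0<..\<tau>}|path_measure T N \<omega>. f u * of_bool (hitting_time T N x \<omega> < ereal u))"
      unfolding set_lebesgue_integral_def
      by (intro Bochner_Integration.integral_cong) (auto simp: indicator_def)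
  qed
  also have "\<dots> = (LINT u:{0<..\<tau>}|intensity_measure. f u * (1 - (\<Sum>k<x. pois k (L u))))"
  proof (rule expectation_grid_limit[where g = ?g and h = ?h and W = "\<lambda>\<omega>. real (N T \<omega>)" and K = K and K' = K])
    show "grid_limit \<tau> (?g \<omega>) (\<lambda>u. f u * of_bool (hitting_time T N x \<omega> < ereal u))" if "\<omega> \<in> space M" for \<omega>
      by (intro grid_limit_mult grid_limit_cadlag[OF f(1) \<tau>(2)] grid_limit_hitting_time that \<tau>(2))
    show "\<bar>?g \<omega> l r\<bar> \<le> K" if "0 \<le> l" "l \<le> r" "r \<le> \<tau>" for \<omega> l r
      using f(2)[of r] that \<tau> K0 by auto
    show "\<bar>?h l r\<bar> \<le> K" if "0 \<le> l" "l \<le> r" "r \<le> \<tau>" for l r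
    proof -
      have "\<bar>?h l r\<bar> \<le> K * 1"
        unfolding abs_mult using that \<tau> K0 by (intro mult_mono f(2) tail_bounds) auto
      then show ?thesis by simp
    qed
    show "has_bochner_integral M (\<lambda>\<omega>. ?g \<omega> l r * measure (path_measure T N \<omega>) {l<..r})
        (?h l r * measure intensity_measure {l<..r})"
      if "0 \<le> l" "l \<le> r" "r \<le> \<tau>" for l r
    proof -
      have r: "r \<le> T" using that \<tau> by simp
      have "has_bochner_integral M
        (\<lambda>\<omega>. f r * (of_bool (x \<le> N l \<omega>) * (real (N r \<omega>) - real (N l \<omega>))))
        (f r * ((1 - (\<Sum>k<x. pois k (L l))) * (L r - L l)))"
        by (intro has_bochner_integral_mult_right expectation_ge_increment that r)
      then show ?thesis
        unfolding measure_intensity_measure[OF that(1,2) r] mult.assoc[symmetric]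
        by (rule has_bochner_integral_cong[THEN iffD1, rotated 3])
           (use measure_path_measure that r in auto)
    qed
    show "measure (path_measure T N \<omega>) {0<..\<tau>} \<le> real (N T \<omega>)" if "\<omega> \<in> space M" for \<omega>
      using measure_path_measure[OF that, of 0 \<tau>] N_mono[OF that, of \<tau> T] \<tau> by simp
    show "integrable M (\<lambda>\<omega>. real (N T \<omega>))" using T_pos by (intro integrable_N) auto
    show "emeasure (path_measure T N \<omega>) {0<..\<tau>} < \<infinity>" if "\<omega> \<in> space M" for \<omega>
      using emeasure_path_measure[OF that, of 0 \<tau>] \<tau> by simp
    show "emeasure intensity_measure {0<..\<tau>} < \<infinity>"
      using emeasure_intensity_measure[of 0 \<tau>] \<tau> by simp
  qed (use \<tau> K0 lim in \<open>auto simp: path_measure_def\<close>)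
  also have "\<dots> = (LINT u:{0<..\<tau>}|lborel. lam u * (f u * (1 - (\<Sum>k<x. pois k (L u)))))"
    by (rule integral_intensity_measure[OF \<tau> grid_limit_measurable[OF \<tau>(1) lim]])
  finally show ?thesis .
qed

context
  fixes c1 c4 \<delta> K :: real and c2 :: "real \<Rightarrow> real"
  assumes c1: "0 \<le> c1" and c4: "0 \<le> c4" and \<delta>: "0 \<le> \<delta>"
    and c2_cadlag: "cadlag T c2" and c2_bounds: "\<forall>t\<in>{0..T}. 0 \<le> c2 t \<and> c2 t \<le> K"
begin

definition marginal_rate :: "nat \<Rightarrow> real \<Rightarrow> real" where
  "marginal_rate x u = exp (- \<delta> * u) * (c1 * pois_cdf x (L u) - lam u * c2 u * pois x (L u))"

definition marginal_cost :: "nat \<Rightarrow> real \<Rightarrow> real" where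
  "marginal_cost x \<tau> = (LINT u:{0<..\<tau>}|lborel. marginal_rate x u) + c4 * exp (- \<delta> * \<tau>) * pois_cdf x (L \<tau>)"

lemma exp_discount_le_1: "0 \<le> u \<Longrightarrow> exp (- \<delta> * u) \<le> 1"
  using \<delta> by simp

lemma cadlag_exp: "cadlag T (\<lambda>u. exp (- \<delta> * u))"
proof -
  have "isCont (\<lambda>u. exp (- \<delta> * u)) t" for t by (intro continuous_intros)
  then show ?thesis
    unfolding cadlag_def by (meson continuous_at_imp_continuous_at_within continuous_within)
qed

lemma set_integrable_holding:
  assumes "0 < \<tau>" "\<tau> \<le> T"
  shows "set_integrable lborel {0<..\<tau>} (\<lambda>u. exp (- \<delta> * u) * pois_cdf x (L u))"
proof (rule set_integrable_grid[OF assms])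
  show "grid_limit \<tau> (\<lambda>l r. exp (- \<delta> * r) * pois_cdf x (L r)) (\<lambda>u. exp (- \<delta> * u) * pois_cdf x (L u))"
    by (intro grid_limit_mult grid_limit_cadlag[OF cadlag_exp assms(2)] grid_limit_right
        continuous_on_pois_cdf continuous_on_L assms(2))
  show "\<bar>exp (- \<delta> * r) * pois_cdf x (L r)\<bar> \<le> 1 * 1" if "0 \<le> l" "l \<le> r" "r \<le> \<tau>" for l r
    unfolding abs_mult using that assms exp_discount_le_1[of r] pois_cdf_L_bounds[of r x]
    by (intro mult_mono) auto
qed

lemma set_integrable_shortage:
  assumes "0 < \<tau>" "\<tau> \<le> T" and p: "continuous_on {0..\<tau>} p" "\<And>u. u \<in> {0..\<tau>} \<Longrightarrow> \<bar>p u\<bar> \<le> 1"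
  shows "set_integrable lborel {0<..\<tau>} (\<lambda>u. lam u * (exp (- \<delta> * u) * c2 u * p u))"
proof (rule set_integrable_grid[OF assms(1,2)])
  show "grid_limit \<tau> (\<lambda>l r. lam r * (exp (- \<delta> * r) * c2 r * p r)) (\<lambda>u. lam u * (exp (- \<delta> * u) * c2 u * p u))"
    by (intro grid_limit_mult grid_limit_cadlag[OF cadlag_exp assms(2)]
        grid_limit_cadlag[OF lam_cadlag assms(2)] grid_limit_cadlag[OF c2_cadlag assms(2)] grid_limit_right p(1))
  show "\<bar>lam r * (exp (- \<delta> * r) * c2 r * p r)\<bar> \<le> lam 0 * (1 * K * 1)" if "0 \<le> l" "l \<le> r" "r \<le> \<tau>" for l r
    unfolding abs_mult using that assms exp_discount_le_1[of r] p(2)[of r] c2_bounds[rule_format, of r] lam_le[of r] lam_nonneg[of r] lam_nonneg[of 0]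
    by (intro mult_mono mult_nonneg_nonneg) auto
qed

lemma set_integrable_marginal_rate:
  assumes "0 < \<tau>" "\<tau> \<le> T"
  shows "set_integrable lborel {0<..\<tau>} (marginal_rate x)"
proof -
  have "set_integrable lborel {0<..\<tau>} (\<lambda>u. c1 * (exp (- \<delta> * u) * pois_cdf x (L u))
      - lam u * (exp (- \<delta> * u) * c2 u * pois x (L u)))"
    using assms pois_L_bounds
    by (intro set_integral_diff set_integrable_mult_right set_integrable_holding set_integrable_shortage
        continuous_on_pois continuous_on_L) auto
  then show ?thesis by (simp add: marginal_rate_def[abs_def] algebra_simps)
qed

lemma cost_difference:
  assumes \<tau>: "0 < \<tau>" "\<tau> \<le> T"
  shows "cost M T N c1 c2 c3 c4 \<delta> (x + 1) \<tau> - cost M T N c1 c2 c3 c4 \<delta> x \<tau> = marginal_cost x \<tau>"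
proof -
  let ?e = "\<lambda>u. exp (- \<delta> * u)"
  have eb: "\<bar>?e t\<bar> \<le> 1" if "t \<in> {0..T}" for t using exp_discount_le_1[of t] that by simp
  have fb: "\<bar>?e t * c2 t\<bar> \<le> 1 * K" if "t \<in> {0..T}" for t
    unfolding abs_mult using eb[OF that] c2_bounds[rule_format, OF that] by (intro mult_mono) auto
  have hold: "(LINT u:{0<..\<tau>}|lborel. ?e u * (\<Sum>k<x + 1. pois_cdf k (L u)))
      - (LINT u:{0<..\<tau>}|lborel. ?e u * (\<Sum>k<x. pois_cdf k (L u)))
      = (LINT u:{0<..\<tau>}|lborel. ?e u * pois_cdf x (L u))"
  proof -
    have I: "set_integrable lborel {0<..\<tau>} (\<lambda>u. ?e u * (\<Sum>k<y. pois_cdf k (L u)))" for y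
      unfolding sum_distrib_left set_integrable_def scaleR_sum_right
      by (intro Bochner_Integration.integrable_sum set_integrable_holding[unfolded set_integrable_def] \<tau>)
    have "?e u * (\<Sum>k<x + 1. pois_cdf k (L u)) - ?e u * (\<Sum>k<x. pois_cdf k (L u)) = ?e u * pois_cdf x (L u)" for u
      by (simp add: algebra_simps)
    then show ?thesis unfolding set_integral_diff(2)[OF I I, symmetric] by simp
  qed
  have short: "(LINT u:{0<..\<tau>}|lborel. lam u * (?e u * c2 u * (1 - (\<Sum>k<x + 1. pois k (L u)))))
      - (LINT u:{0<..\<tau>}|lborel. lam u * (?e u * c2 u * (1 - (\<Sum>k<x. pois k (L u)))))
      = - (LINT u:{0<..\<tau>}|lborel. lam u * (?e u * c2 u * pois x (L u)))"
  proof -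
    have I: "set_integrable lborel {0<..\<tau>} (\<lambda>u. lam u * (?e u * c2 u * (1 - (\<Sum>k<y. pois k (L u)))))" for y
      using \<tau> tail_bounds
      by (intro set_integrable_shortage continuous_on_sum continuous_on_pois continuous_on_diff
          continuous_on_const continuous_on_L) auto
    have "lam u * (?e u * c2 u * (1 - (\<Sum>k<x + 1. pois k (L u)))) - lam u * (?e u * c2 u * (1 - (\<Sum>k<x. pois k (L u))))
        = - (lam u * (?e u * c2 u * pois x (L u)))" for u
      by (simp add: algebra_simps)
    then show ?thesis
      unfolding set_integral_diff(2)[OF I I, symmetric] by (simp add: set_lebesgue_integral_def)
  qed
  have terminal: "(LINT \<omega>|M. max (real y - real (N \<tau> \<omega>)) 0) = (\<Sum>k<y. pois_cdf k (L \<tau>))" for y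
    using expectation_pos_part[of \<tau> y] \<tau> by (simp add: has_bochner_integral_iff)
  have rate: "(LINT u:{0<..\<tau>}|lborel. marginal_rate x u) =
      c1 * (LINT u:{0<..\<tau>}|lborel. ?e u * pois_cdf x (L u))
      - (LINT u:{0<..\<tau>}|lborel. lam u * (?e u * c2 u * pois x (L u)))"
  proof -
    have "(LINT u:{0<..\<tau>}|lborel. marginal_rate x u) =
      (LINT u:{0<..\<tau>}|lborel. c1 * (?e u * pois_cdf x (L u)) - lam u * (?e u * c2 u * pois x (L u)))"
      by (simp add: marginal_rate_def[abs_def] algebra_simps)
    also have "\<dots> = (LINT u:{0<..\<tau>}|lborel. c1 * (?e u * pois_cdf x (L u)))
        - (LINT u:{0<..\<tau>}|lborel. lam u * (?e u * c2 u * pois x (L u)))"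
      using \<tau> pois_L_bounds
      by (intro set_integral_diff set_integrable_mult_right set_integrable_holding set_integrable_shortage
        continuous_on_pois continuous_on_L) auto
    finally show ?thesis by simp
  qed
  have d: "c1 * H' + P' + t + e4 * W' - (c1 * H + P + t + e4 * W)
      = c1 * (H' - H) + (P' - P) + e4 * (W' - W)" for H H' P P' t e4 W W' :: real
    by (simp add: algebra_simps)
  have "(LINT \<omega>|M. (LINT u:{0..\<tau>}|lborel. ?e u * max (real y - real (N u \<omega>)) 0)) =
      (LINT u:{0<..\<tau>}|lborel. ?e u * (\<Sum>k<y. pois_cdf k (L u)))" for y
    by (rule expectation_holding_integral[OF \<tau> cadlag_exp eb])
  moreover have "(LINT \<omega>|M. (LINT u:{u. min (ereal \<tau>) (hitting_time T N y \<omega>) < ereal u \<and> u \<le> \<tau>}|path_measure T N \<omega>. ?e u * c2 u)) =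
      (LINT u:{0<..\<tau>}|lborel. lam u * (?e u * c2 u * (1 - (\<Sum>k<y. pois k (L u)))))" for y
    by (rule expectation_path_integral[OF \<tau> cadlag_mult[OF cadlag_exp c2_cadlag] fb])
  ultimately show ?thesis
    unfolding cost_def terminal by (simp only: d hold short) (simp add: marginal_cost_def rate)
qed

lemma marginal_cost_antimono:
  assumes "0 < a" "a \<le> b" "b \<le> T"
    and le: "\<And>u. a < u \<Longrightarrow> u \<le> b \<Longrightarrow> c1 * pois_cdf x (L u) \<le> lam u * c2 u * pois x (L u)"
  shows "marginal_cost x b \<le> marginal_cost x a"
proof -
  have I: "set_integrable lborel {0<..b} (marginal_rate x)"
    using assms by (intro set_integrable_marginal_rate) auto
  have "{0<..b} = {0<..a} \<union> {a<..b}" using assms by auto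
  then have "(LINT u:{0<..b}|lborel. marginal_rate x u) =
      (LINT u:{0<..a}|lborel. marginal_rate x u) + (LINT u:{a<..b}|lborel. marginal_rate x u)"
    using assms by (simp only:, intro set_integral_Un set_integrable_subset[OF I]) auto
  moreover have "(LINT u:{a<..b}|lborel. marginal_rate x u) \<le> 0"
  proof -
    have "marginal_rate x u \<le> 0" if "u \<in> {a<..b}" for u
      using le[of u] that by (auto simp: marginal_rate_def intro!: mult_nonneg_nonpos)
    then have "0 \<le> (LINT u|lborel. - (indicator {a<..b} u *\<^sub>R marginal_rate x u))"
      by (intro Bochner_Integration.integral_nonneg) (auto simp: indicator_def)
    then show ?thesis by (simp add: set_lebesgue_integral_def)
  qed
  moreover have "c4 * (exp (- \<delta> * b) * pois_cdf x (L b)) \<le> c4 * (exp (- \<delta> * a) * pois_cdf x (L a))"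
    using assms c4 \<delta> pois_cdf_L_antimono[of a b x] pois_cdf_L_bounds[of b x]
    by (intro mult_left_mono mult_mono) (auto intro: mult_left_mono)
  ultimately show ?thesis unfolding marginal_cost_def by (simp add: mult.assoc)
qed

lemma marginal_cost_eventually:
  assumes \<tau>: "0 < \<tau>" "\<tau> \<le> T" and cbar: "0 \<le> cbar" "0 < cbar + c4"
  shows "\<exists>x. 0 \<le> cbar + marginal_cost x \<tau>"
proof -
  define a where "a x = L \<tau> ^ x / fact x" for x
  have K: "0 \<le> K" using c2_bounds[rule_format, of 0] T_pos by auto
  have rate: "- (lam 0 * K * a x) \<le> marginal_rate x u" if u: "u \<in> {0<..\<tau>}" for x u
  proof -
    have uT: "0 \<le> u" "u \<le> T" using u \<tau> by auto
    have "pois x (L u) \<le> a x * 1"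
      unfolding pois_def a_def using u \<tau> L_mono[of u \<tau>] L_nonneg[OF uT]
      by (intro mult_mono divide_right_mono power_mono) auto
    then have "exp (- \<delta> * u) * (lam u * c2 u * pois x (L u)) \<le> 1 * (lam 0 * K * a x)"
      using uT exp_discount_le_1[of u] c2_bounds[rule_format, of u] lam_le[of u] lam_nonneg[of u] lam_nonneg[of 0] T_pos K pois_L_bounds[OF uT, of x]
      by (intro mult_mono mult_nonneg_nonneg) auto
    moreover have "0 \<le> exp (- \<delta> * u) * (c1 * pois_cdf x (L u))"
      using c1 pois_cdf_L_bounds[OF uT, of x] by (intro mult_nonneg_nonneg) auto
    ultimately show ?thesis unfolding marginal_rate_def right_diff_distrib by linarith
  qed
  have ind: "integrable lborel (indicat_real {0<..\<tau>})"
    using \<tau> by (intro integrable_real_indicator) auto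
  have int: "- (lam 0 * K * a x) * \<tau> \<le> (LINT u:{0<..\<tau>}|lborel. marginal_rate x u)" for x
  proof -
    have "(LINT u:{0<..\<tau>}|lborel. - (lam 0 * K * a x)) \<le> (LINT u:{0<..\<tau>}|lborel. marginal_rate x u)"
      using ind
      by (intro set_integral_mono set_integrable_marginal_rate \<tau> rate) (auto simp: set_integrable_def)
    then show ?thesis using \<tau> by (simp add: set_lebesgue_integral_def mult_ac)
  qed
  have "a \<longlonglongrightarrow> 0"
    unfolding a_def using summable_LIMSEQ_zero[OF sums_summable[OF exp_series_sums[of "L \<tau>"]]] .
  then have "(\<lambda>x. cbar + (- (lam 0 * K * a x) * \<tau> + c4 * exp (- \<delta> * \<tau>) * pois_cdf x (L \<tau>)))
      \<longlonglongrightarrow> cbar + (- (lam 0 * K * 0) * \<tau> + c4 * exp (- \<delta> * \<tau>) * 1)"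
    by (intro tendsto_intros pois_cdf_tendsto)
  moreover have "0 < cbar + (- (lam 0 * K * 0) * \<tau> + c4 * exp (- \<delta> * \<tau>) * 1)"
    using cbar c4 by (cases "c4 = 0") (auto intro: add_nonneg_pos)
  ultimately have "\<forall>\<^sub>F x in sequentially. 0 < cbar + (- (lam 0 * K * a x) * \<tau> + c4 * exp (- \<delta> * \<tau>) * pois_cdf x (L \<tau>))"
    by (rule order_tendstoD(1))
  then obtain x where "0 < cbar + (- (lam 0 * K * a x) * \<tau> + c4 * exp (- \<delta> * \<tau>) * pois_cdf x (L \<tau>))"
    by (auto simp: eventually_sequentially)
  then show ?thesis using int[of x] unfolding marginal_cost_def by (intro exI[of _ x]) linarith
qed

end

end

theorem proposition3p7:
  fixes M :: "'a measure" and N :: "real \<Rightarrow> 'a \<Rightarrow> nat"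
    and T cbar c1 c4 \<delta> :: real
    and lam c2 c3 :: "real \<Rightarrow> real"
    and \<epsilon> \<tau>1 \<tau>2 :: real
  defines "S \<equiv> order_up_to M T N cbar c1 c2 c3 c4 \<delta>"
    and "\<Lambda> \<equiv> cum_intensity lam"
  assumes T: "0 \<le> T"
    and lam_nonneg: "\<forall>t\<in>{0..T}. 0 \<le> lam t"
    and lam_reg: "cadlag T lam" "differentiable_except_finite T lam"
    and N: "nh_poisson_process M T lam N"
    and params: "0 \<le> cbar" "0 \<le> c1" "cbar > - c4" "\<delta> \<in> {0..1}"
    and costs_nonneg: "\<forall>t\<in>{0..T}. 0 \<le> c2 t" "\<forall>t\<in>{0..T}. 0 \<le> c3 t"
    and noninc_c3: "cadlag T c3" "differentiable_except_finite T c3" "antimono_on {0..T} c3"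
    and noninc_c2: "cadlag T (\<lambda>t. c2 t - c3 t)"
      "differentiable_except_finite T (\<lambda>t. c2 t - c3 t)"
      "antimono_on {0..T} (\<lambda>t. c2 t - c3 t)"
    and pos: "\<forall>t\<in>{0..T}. 0 \<le> c3 t" "\<forall>t\<in>{0..T}. 0 \<le> c2 t - c3 t" "0 \<le> c4" "0 \<le> c1 - \<delta> * c4"
    and lam_noninc: "antimono_on {0..T} lam"
    and times: "\<epsilon> \<in> {0..T}" "\<tau>1 \<in> {0..T}" "\<tau>2 \<in> {0..T}" "\<tau>2 + \<epsilon> \<le> T"
    and i: "\<tau>1 < \<tau>2"
    and ii: "S \<tau>1 \<ge> S \<tau>2"
    and iii: "real (S \<tau>1) \<le> \<Lambda> \<tau>2"
    and iv: "\<forall>u\<in>{\<tau>2..\<tau>2 + \<epsilon>}. 0 < \<Lambda> u \<and> c1 \<le> (\<Lambda> u - real (S \<tau>1)) / \<Lambda> u * lam u * c3 u"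
  shows "S \<tau>2 \<le> S (\<tau>2 + \<epsilon>)"
proof -
  have T_pos: "0 < T" using times i by auto
  have "prob_space M" using N by (simp add: nh_poisson_process_def)
  then interpret nh_poisson M T lam N
    by (intro nh_poisson.intro nh_poisson_axioms.intro)
       (use T_pos lam_nonneg lam_reg(1) lam_noninc N in auto)
  have c2_cadlag: "cadlag T c2"
    using cadlag_add[OF noninc_c2(1) noninc_c3(1)] by simp
  have c2_bounds: "\<forall>t\<in>{0..T}. 0 \<le> c2 t \<and> c2 t \<le> c2 0"
  proof
    fix t assume "t \<in> {0..T}"
    then show "0 \<le> c2 t \<and> c2 t \<le> c2 0"
      using monotone_onD[OF noninc_c3(3), of 0 t] monotone_onD[OF noninc_c2(3), of 0 t]
        costs_nonneg(1) by auto
  qed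
  have \<delta>: "0 \<le> \<delta>" using params(4) by simp
  let ?D = "marginal_cost c1 c4 \<delta> c2"
  let ?b = "\<tau>2 + \<epsilon>"
  have \<tau>2: "0 < \<tau>2" "\<tau>2 \<le> T" "0 < ?b" "?b \<le> T" "\<tau>2 \<le> ?b" using times i by auto
  have S_eq: "S \<tau> = (LEAST x. 0 \<le> cbar + ?D x \<tau>)" if "0 < \<tau>" "\<tau> \<le> T" for \<tau>
    unfolding S_def order_up_to_def
    using cost_difference[OF params(2) pos(3) \<delta> c2_cadlag c2_bounds that] by simp
  have "\<exists>x. 0 \<le> cbar + ?D x ?b"
    using marginal_cost_eventually[OF params(2) pos(3) \<delta> c2_cadlag c2_bounds \<tau>2(3,4)] params by simp
  then have at_b: "0 \<le> cbar + ?D (S ?b) ?b"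
    unfolding S_eq[OF \<tau>2(3,4)] by (rule LeastI_ex)
  show ?thesis
  proof (rule ccontr)
    assume "\<not> S \<tau>2 \<le> S ?b"
    then have less: "S ?b < S \<tau>2" by simp
    define x where "x = S ?b"
    have x: "x < S \<tau>1" using less ii x_def by simp
    have "?D x ?b \<le> ?D x \<tau>2"
    proof (rule marginal_cost_antimono[OF params(2) pos(3) \<delta> c2_cadlag c2_bounds \<tau>2(1,5,4)])
      fix u assume u: "\<tau>2 < u" "u \<le> ?b"
      then have uT: "u \<in> {0..T}" using \<tau>2 by auto
      let ?m = "\<Lambda> u"
      have m: "0 < ?m" and c1: "c1 \<le> (?m - real (S \<tau>1)) / ?m * lam u * c3 u"
        using iv u by auto
      have P: "0 \<le> pois_cdf x ?m" "0 \<le> pois x ?m"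
        using m by (auto intro: pois_cdf_nonneg pois_nonneg)
      have lam: "0 \<le> lam u" and c3: "0 \<le> c3 u" "c3 u \<le> c2 u"
        using lam_nonneg pos uT by auto
      have "pois_cdf x ?m * (?m - real (S \<tau>1)) \<le> pois_cdf x ?m * (?m - real x)"
        using P x by (intro mult_left_mono) auto
      also have "\<dots> \<le> ?m * pois x ?m" using m by (intro pois_cdf_le_pois) simp
      finally have "(?m - real (S \<tau>1)) / ?m * pois_cdf x ?m \<le> pois x ?m"
        using m by (simp add: pos_divide_le_eq mult.commute)
      then have "lam u * c3 u * ((?m - real (S \<tau>1)) / ?m * pois_cdf x ?m) \<le> lam u * c3 u * pois x ?m"
        using lam c3 by (intro mult_left_mono) auto
      also have "\<dots> \<le> lam u * c2 u * pois x ?m"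
        using lam c3 P by (simp add: mult_left_mono mult_right_mono)
      finally have "lam u * c3 u * ((?m - real (S \<tau>1)) / ?m * pois_cdf x ?m) \<le> lam u * c2 u * pois x ?m" .
      moreover have "c1 * pois_cdf x ?m \<le> (?m - real (S \<tau>1)) / ?m * lam u * c3 u * pois_cdf x ?m"
        by (rule mult_right_mono[OF c1 P(1)])
      ultimately show "c1 * pois_cdf x (cum_intensity lam u) \<le> lam u * c2 u * pois x (cum_intensity lam u)"
        unfolding \<Lambda>_def by (simp add: mult_ac)
    qed
    then have "0 \<le> cbar + ?D x \<tau>2" using at_b x_def by simp
    then have "S \<tau>2 \<le> x" unfolding S_eq[OF \<tau>2(1,2)] by (rule Least_le)
    then show False using less x_def by simp
  qed
qed

end
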